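(* Let $\delta,\varepsilon$ be real numbers such that $2/5 \leq \delta \leq 3$ and $\varepsilon>0$. Then there exist an integer $n$ which is not a perfect square and a $D(n)$-quadruple $\{a,b,c,d\}$ such that $$\left|\frac{\log(\max\{|a|,|b|,|c|,|d|\})}{\log|n|}-\delta\right|<\varepsilon.$$
   Context: For a nonzero integer $n$, a $D(n)$-quadruple is a set $\{a,b,c,d\}$ of four distinct nonzero integers such that the product of any two distinct elements of the set, increased by $n$, is a perfect square (the square of an integer). *)

theory Defs
  imports Complex_Main "HOL-Computational_Algebra.Nth_Powers"
begin

definition D_quadruple :: "int \<Rightarrow> int set \<Rightarrow> bool" where
  "D_quadruple n S \<longleftrightarrow>
     n \<noteq> 0 \<and> card S = 4 \<and> 0 \<notin> S \<and>
     (\<forall>x\<in>S. \<forall>y\<in>S. x \<noteq> y \<longrightarrow> is_square (x * y + n))"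

end

theory Submission
  imports Defs "HOL-Number_Theory.Cong" "HOL-Real_Asymp.Real_Asymp"
begin

text \<open>
  Multiplying a \<open>D(n)\<close>-quadruple by \<open>k\<close> yields a \<open>D(k\<^sup>2 n)\<close>-quadruple. If
  the largest element has order \<open>t\<^sup>A\<close> and \<open>n\<close> has order \<open>t\<^sup>B\<close>, then
  \<open>k \<approx> t\<^sup>s\<close> gives the exponent \<open>(A + s) / (B + 2 s)\<close>, which runs
  continuously from \<open>A / B\<close> to the limit \<open>1 / 2\<close>. Hence two polynomial families suffice, one with
  \<open>A / B = 4 / 10\<close> and one with \<open>A / B = 8 / 2\<close>.
  The second family comes from quadruples
  \<open>(\<sigma>\<^sup>2 - 1) / \<omega>, (\<lambda>\<^sup>2 - 1) / \<omega>, (\<mu>\<^sup>2 - 1) / \<omega>, (\<nu>\<^sup>2 - 1) / \<omega>\<close>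
  with \<open>\<sigma> + \<nu> = 2 \<lambda> \<mu>\<close> and \<open>\<omega>\<^sup>2 n = \<lambda>\<^sup>2 + \<mu>\<^sup>2 - 1 - \<sigma> \<nu>\<close>, for which
  five of the six conditions are automatic.
\<close>

section \<open>Quadruples and their integer multiples\<close>

lemma D_quadrupleI:
  assumes "n \<noteq> 0" "distinct [a, b, c, d]" "0 \<notin> {a, b, c, d}"
    and "a * b + n = p1\<^sup>2" "a * c + n = p2\<^sup>2" "a * d + n = p3\<^sup>2"
    and "b * c + n = p4\<^sup>2" "b * d + n = p5\<^sup>2" "c * d + n = p6\<^sup>2"
  shows "D_quadruple n {a, b, c, d}"
proof -
  have sq: "is_square (a * b + n)" "is_square (a * c + n)" "is_square (a * d + n)"
    "is_square (b * c + n)" "is_square (b * d + n)" "is_square (c * d + n)"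
    using assms(4-9) by (simp_all add: is_nth_power_nth_power)
  then show ?thesis
    unfolding D_quadruple_def using assms(1-3) by (auto simp: mult.commute)
qed

lemma D_quadruple_scale:
  assumes "D_quadruple n S" "k \<noteq> 0"
  shows "D_quadruple (k\<^sup>2 * n) ((*) k ` S)"
proof -
  have "is_square (k * x * (k * y) + k\<^sup>2 * n)" if "is_square (x * y + n)" for x y
  proof -
    have "k * x * (k * y) + k\<^sup>2 * n = k\<^sup>2 * (x * y + n)"
      by (simp add: algebra_simps power2_eq_square)
    then show ?thesis
      using that by (simp add: is_nth_power_mult)
  qed
  then show ?thesis
    using assms unfolding D_quadruple_def
    by (auto simp: card_image inj_on_def)
qed

text \<open>The forward direction rests on \<open>k\<^sup>2 dvd m\<^sup>2\<close> forcing
  \<open>k dvd m\<close>. This keeps the scaled \<open>n\<close> a non-square.\<close>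

lemma is_square_scale_iff:
  fixes k n :: int
  assumes "k \<noteq> 0"
  shows "is_square (k\<^sup>2 * n) \<longleftrightarrow> is_square n"
proof
  assume "is_square (k\<^sup>2 * n)"
  then obtain m where m: "k\<^sup>2 * n = m\<^sup>2"
    by (auto elim: is_nth_powerE)
  then have "k\<^sup>2 dvd m\<^sup>2"
    by (metis dvd_triv_left)
  then obtain l where "m = k * l"
    by auto
  with m assms have "n = l\<^sup>2"
    by (simp add: power_mult_distrib)
  then show "is_square n"
    by simp
qed (simp add: is_nth_power_mult)

lemma Max_abs_scale:
  fixes a b c d k :: int
  assumes "k > 0"
  shows "Max {\<bar>k * a\<bar>, \<bar>k * b\<bar>, \<bar>k * c\<bar>, \<bar>k * d\<bar>} = k * Max {\<bar>a\<bar>, \<bar>b\<bar>, \<bar>c\<bar>, \<bar>d\<bar>}"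
proof -
  have "mono (\<lambda>x. k * x)"
    using assms by (intro monoI mult_left_mono) auto
  then have "k * Max {\<bar>a\<bar>, \<bar>b\<bar>, \<bar>c\<bar>, \<bar>d\<bar>} = Max ((*) k ` {\<bar>a\<bar>, \<bar>b\<bar>, \<bar>c\<bar>, \<bar>d\<bar>})"
    by (rule mono_Max_commute) auto
  also have "(*) k ` {\<bar>a\<bar>, \<bar>b\<bar>, \<bar>c\<bar>, \<bar>d\<bar>} = {\<bar>k * a\<bar>, \<bar>k * b\<bar>, \<bar>k * c\<bar>, \<bar>k * d\<bar>}"
    using assms by (simp only: image_insert image_empty abs_mult abs_of_pos)
  finally show ?thesis ..
qed

section \<open>Limits of ratios of logarithms\<close>

text \<open>For \<open>t > 1\<close> the power is at least 1, so rounding up at most doubles it. The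
  logarithm changes by at most \<open>ln 2\<close>, which vanishes against
  \<open>ln t\<close>.\<close>

lemma ln_ceiling_powr_over_ln:
  fixes s :: real
  assumes "s \<ge> 0"
  shows "(\<lambda>t::nat. ln (real_of_int \<lceil>real t powr s\<rceil>) / ln (real t)) \<longlonglongrightarrow> s"
proof (rule tendsto_sandwich)
  show "\<forall>\<^sub>F t in sequentially. s \<le> ln (real_of_int \<lceil>real t powr s\<rceil>) / ln (real t)"
    using eventually_gt_at_top[of 1]
  proof eventually_elim
    case (elim t)
    then have "real t powr s > 0"
      by simp
    then have "ln (real t powr s) \<le> ln (real_of_int \<lceil>real t powr s\<rceil>)"
      by (subst ln_le_cancel_iff) (use le_of_int_ceiling[of "real t powr s"] in linarith)+
    with elim show ?case
      by (simp add: ln_powr field_simps)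
  qed
  show "\<forall>\<^sub>F t in sequentially.
      ln (real_of_int \<lceil>real t powr s\<rceil>) / ln (real t) \<le> ln 2 / ln (real t) + s"
    using eventually_gt_at_top[of 1]
  proof eventually_elim
    case (elim t)
    then have ge1: "real t powr s \<ge> 1"
      using assms by (simp add: ge_one_powr_ge_zero)
    then have "ln (real_of_int \<lceil>real t powr s\<rceil>) \<le> ln (2 * real t powr s)"
      by (subst ln_le_cancel_iff) linarith+
    also have "\<dots> = ln 2 + s * ln (real t)"
      using elim by (simp add: ln_mult ln_powr)
    finally show ?case
      using elim by (simp add: field_simps)
  qed
  show "(\<lambda>t::nat. ln 2 / ln (real t) + s) \<longlonglongrightarrow> s"
    by real_asymp
qed simp

text \<open>Only the growth exponents \<open>A\<close> and \<open>B\<close> of a family enter the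
  limit, so both families go through this one statement, each with its own \<open>s\<close>.\<close>

lemma scaled_family_exponent:
  fixes a b c d n :: "nat \<Rightarrow> int" and A B s \<epsilon> :: real
  defines "M \<equiv> \<lambda>t. Max {\<bar>a t\<bar>, \<bar>b t\<bar>, \<bar>c t\<bar>, \<bar>d t\<bar>}"
  assumes nsq: "\<And>t. t > 0 \<Longrightarrow> \<not> is_square (n t)"
    and quad: "\<And>t. t > 0 \<Longrightarrow> D_quadruple (n t) {a t, b t, c t, d t}"
    and A: "(\<lambda>t. ln (real_of_int (M t)) / ln (real t)) \<longlonglongrightarrow> A"
    and B: "(\<lambda>t. ln (real_of_int \<bar>n t\<bar>) / ln (real t)) \<longlonglongrightarrow> B"
    and n1: "\<And>t. t > 0 \<Longrightarrow> \<bar>n t\<bar> > 1"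
    and s: "s \<ge> 0" and Bs: "B + 2 * s \<noteq> 0" and "\<epsilon> > 0"
  shows "\<exists>n a b c d :: int.
           \<not> is_square n \<and> \<bar>n\<bar> > 1 \<and> D_quadruple n {a, b, c, d} \<and>
           \<bar>ln (real_of_int (Max {\<bar>a\<bar>, \<bar>b\<bar>, \<bar>c\<bar>, \<bar>d\<bar>})) / ln (real_of_int \<bar>n\<bar>)
             - (A + s) / (B + 2 * s)\<bar> < \<epsilon>"
proof -
  define k where "k t = \<lceil>real t powr s\<rceil>" for t :: nat
  \<comment> \<open>\<open>L t\<close> is the exact ratio of logarithms for the quadruple scaled by
    \<open>k t\<close>. Dividing numerator and denominator by \<open>ln t\<close> expresses it
    through three ratios with known limits.\<close>
  define L where "L t = (ln (real_of_int (M t)) + ln (real_of_int (k t))) /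
    (ln (real_of_int \<bar>n t\<bar>) + 2 * ln (real_of_int (k t)))" for t
  have k: "(\<lambda>t. ln (real_of_int (k t)) / ln (real t)) \<longlonglongrightarrow> s"
    unfolding k_def using s by (rule ln_ceiling_powr_over_ln)
  have "(\<lambda>t. (ln (real_of_int (M t)) / ln (real t) + ln (real_of_int (k t)) / ln (real t)) /
      (ln (real_of_int \<bar>n t\<bar>) / ln (real t) + 2 * (ln (real_of_int (k t)) / ln (real t))))
      \<longlonglongrightarrow> (A + s) / (B + 2 * s)"
    by (intro tendsto_intros A B k Bs)
  moreover have "\<forall>\<^sub>F t in sequentially.
      (ln (real_of_int (M t)) / ln (real t) + ln (real_of_int (k t)) / ln (real t)) /
      (ln (real_of_int \<bar>n t\<bar>) / ln (real t) + 2 * (ln (real_of_int (k t)) / ln (real t))) = L t"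
    using eventually_gt_at_top[of 1]
  proof eventually_elim
    case (elim t)
    then have "ln (real t) \<noteq> 0"
      by simp
    then show ?case
      unfolding L_def times_divide_eq_right add_divide_distrib[symmetric] by simp
  qed
  ultimately have "L \<longlonglongrightarrow> (A + s) / (B + 2 * s)"
    by (rule Lim_transform_eventually)
  then have "\<forall>\<^sub>F t in sequentially. dist (L t) ((A + s) / (B + 2 * s)) < \<epsilon>"
    using \<open>\<epsilon> > 0\<close> by (rule tendstoD)
  then have "\<forall>\<^sub>F t in sequentially. dist (L t) ((A + s) / (B + 2 * s)) < \<epsilon> \<and> 0 < t"
    using eventually_gt_at_top by (rule eventually_conj)
  then have "\<exists>t. dist (L t) ((A + s) / (B + 2 * s)) < \<epsilon> \<and> 0 < t"
    using eventually_happens trivial_limit_sequentially by blast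
  then obtain t where t: "t > 0" and close: "\<bar>L t - (A + s) / (B + 2 * s)\<bar> < \<epsilon>"
    unfolding dist_real_def by blast
  from t have kpos: "k t > 0"
    by (simp add: k_def)
  \<comment> \<open>Entries are nonzero, so \<open>M t > 0\<close> and the logarithm of
    \<open>k t * M t\<close> splits.\<close>
  have "card {a t, b t, c t, d t} = 4" "0 \<notin> {a t, b t, c t, d t}"
    using quad[OF t] by (auto simp: D_quadruple_def)
  then have "\<bar>a t\<bar> > 0"
    by auto
  also have "\<bar>a t\<bar> \<le> M t"
    by (simp add: M_def)
  finally have Mpos: "M t > 0" .
  have "Max {\<bar>k t * a t\<bar>, \<bar>k t * b t\<bar>, \<bar>k t * c t\<bar>, \<bar>k t * d t\<bar>} = k t * M t"
    unfolding M_def using kpos by (rule Max_abs_scale)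
  moreover have "ln (real_of_int (k t * M t)) = ln (real_of_int (M t)) + ln (real_of_int (k t))"
    using kpos Mpos by (simp add: ln_mult)
  moreover have "ln (real_of_int \<bar>(k t)\<^sup>2 * n t\<bar>) =
      ln (real_of_int \<bar>n t\<bar>) + 2 * ln (real_of_int (k t))"
    using kpos n1[OF t] by (simp add: abs_mult ln_mult ln_realpow)
  ultimately have "ln (real_of_int (Max {\<bar>k t * a t\<bar>, \<bar>k t * b t\<bar>, \<bar>k t * c t\<bar>, \<bar>k t * d t\<bar>})) /
      ln (real_of_int \<bar>(k t)\<^sup>2 * n t\<bar>) = L t"
    by (simp add: L_def)
  moreover have "D_quadruple ((k t)\<^sup>2 * n t) {k t * a t, k t * b t, k t * c t, k t * d t}"
    using D_quadruple_scale[OF quad[OF t], of "k t"] kpos by simp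
  moreover have "\<not> is_square ((k t)\<^sup>2 * n t)"
    using nsq[OF t] kpos by (simp add: is_square_scale_iff)
  moreover have "\<bar>(k t)\<^sup>2 * n t\<bar> > 1"
  proof -
    have "1 * \<bar>n t\<bar> \<le> (k t)\<^sup>2 * \<bar>n t\<bar>"
      using kpos by (intro mult_right_mono) (auto simp: one_le_power)
    with n1[OF t] show ?thesis
      by (simp add: abs_mult)
  qed
  ultimately show ?thesis
    using close by metis
qed

section \<open>Quadratic non-residues\<close>

lemma nonsquare_mod_5:
  fixes n :: int
  assumes "n mod 5 = 3"
  shows "\<not> is_square n"
proof
  assume "is_square n"
  then obtain r where r: "n = r\<^sup>2"
    by (auto elim: is_nth_powerE)
  have "r mod 5 \<in> {0, 1, 2, 3, 4}"
    by auto
  then have "(r mod 5)\<^sup>2 mod 5 \<noteq> 3"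
    by auto
  with assms r show False
    by (simp add: power_mod)
qed

lemma nonsquare_mod_11:
  fixes n :: int
  assumes "n mod 11 = 2"
  shows "\<not> is_square n"
proof
  assume "is_square n"
  then obtain r where r: "n = r\<^sup>2"
    by (auto elim: is_nth_powerE)
  have "r mod 11 \<in> {0, 1, 2, 3, 4, 5, 6, 7, 8, 9, 10}"
    unfolding insert_iff empty_iff by presburger
  then have "(r mod 11)\<^sup>2 mod 11 \<noteq> 2"
    by auto
  with assms r show False
    by (simp add: power_mod)
qed

section \<open>Two polynomial families\<close>

text \<open>The instance \<sigma> = 5t/4, \<lambda> = (25s - 4)/12, \<mu> = t(25s - 11)/4, \<omega>
  = (25s - 16)/576 of the construction with \<sigma> + \<nu> = 2 \<lambda> \<mu>.\<close>

lemma high_family: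
  fixes t s :: int
  defines "s \<equiv> t\<^sup>2"
  assumes "t \<ge> 5"
  shows "D_quadruple (1152 * (3 * s - 1))
    {36, 4 * (25 * s + 8), 36 * (25 * s\<^sup>2 - 6 * s + 1),
     15625 * s ^ 4 - 8750 * s ^ 3 + 725 * s\<^sup>2 + 44 * s + 36}"
    and "Max {\<bar>36\<bar>, \<bar>4 * (25 * s + 8)\<bar>, \<bar>36 * (25 * s\<^sup>2 - 6 * s + 1)\<bar>,
     \<bar>15625 * s ^ 4 - 8750 * s ^ 3 + 725 * s\<^sup>2 + 44 * s + 36\<bar>} =
     15625 * s ^ 4 - 8750 * s ^ 3 + 725 * s\<^sup>2 + 44 * s + 36"
proof -
  let ?a = "36::int" and ?b = "4 * (25 * s + 8)" and ?c = "36 * (25 * s\<^sup>2 - 6 * s + 1)"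
  let ?d = "15625 * s ^ 4 - 8750 * s ^ 3 + 725 * s\<^sup>2 + 44 * s + 36"
  have "5 * 5 \<le> t * t"
    using assms(2) by (intro mult_mono) auto
  then have s: "s \<ge> 25"
    by (simp add: s_def power2_eq_square)
  have ab: "?a < ?b"
    using s by simp
  \<comment> \<open>Comparing consecutive powers of \<open>s\<close> reduces the ordering of the
    entries to linear arithmetic with the powers as atoms.\<close>
  have "25 * s \<le> s * s"
    using s by (intro mult_right_mono) auto
  then have s2: "25 * s \<le> s\<^sup>2"
    by (simp add: power2_eq_square)
  with s have bc: "?b < ?c"
    by simp
  have "25 * s\<^sup>2 \<le> s * s\<^sup>2"
    using s by (intro mult_right_mono) auto
  then have s3: "25 * s\<^sup>2 \<le> s ^ 3"
    by (simp add: power2_eq_square power3_eq_cube)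
  have "25 * s ^ 3 \<le> s * s ^ 3"
    using s by (intro mult_right_mono) auto
  then have s4: "25 * s ^ 3 \<le> s ^ 4"
    by (simp add: power4_eq_xxxx power3_eq_cube mult.assoc)
  from s s2 s3 s4 have cd: "?c < ?d"
    by simp
  show "Max {\<bar>?a\<bar>, \<bar>?b\<bar>, \<bar>?c\<bar>, \<bar>?d\<bar>} = ?d"
    using ab bc cd by simp
  show "D_quadruple (1152 * (3 * s - 1)) {?a, ?b, ?c, ?d}"
  proof (rule D_quadrupleI)
    show "?a * ?b + 1152 * (3 * s - 1) = (84 * t)\<^sup>2"
      unfolding s_def by algebra
    show "?a * ?c + 1152 * (3 * s - 1) = (12 * (15 * s - 1))\<^sup>2"
      by algebra
    \<comment> \<open>The one condition not automatic in the construction: it pairs the entries of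
      \<sigma> and \<nu>.\<close>
    show "?a * ?d + 1152 * (3 * s - 1) = (750 * s\<^sup>2 - 210 * s - 12)\<^sup>2"
      by algebra
    show "?b * ?c + 1152 * (3 * s - 1) = (12 * t * (25 * s + 1))\<^sup>2"
      unfolding s_def by algebra
    show "?b * ?d + 1152 * (3 * s - 1) = (2 * t * (625 * s\<^sup>2 - 75 * s - 46))\<^sup>2"
      unfolding s_def by algebra
    show "?c * ?d + 1152 * (3 * s - 1) = (6 * (625 * s ^ 3 - 250 * s\<^sup>2 + 19 * s - 2))\<^sup>2"
      by algebra
  qed (use s ab bc cd in auto)
qed

text \<open>
  Four of the six conditions hold for all \<open>\<alpha> \<plusminus> \<beta>, 2 t\<^sup>2 \<alpha> \<plusminus> 2 t \<epsilon>\<close> with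
  \<open>n = t\<^sup>2 (\<beta>\<^sup>2 - \<alpha>\<^sup>2) + \<epsilon>\<^sup>2\<close>; here \<open>\<alpha> = 6 - 7 X\<close>, \<open>\<beta> = -12 X\<^sup>2 + 19 X - 6\<close>
  and \<open>\<epsilon> = 5 t (1 - X)\<close> are chosen to satisfy the other two.
\<close>

lemma low_family:
  fixes t X :: int
  defines "X \<equiv> t\<^sup>2"
  assumes "t \<ge> 2"
  shows "D_quadruple (X * (X - 1) * (4 * X - 1) * (36 * X\<^sup>2 - 69 * X + 25))
    {- 12 * X * (X - 1), 2 * (2 * X - 3) * (3 * X - 2), - 2 * X * (12 * X - 11), - 2 * X * (2 * X - 1)}"
    and "Max {\<bar>- 12 * X * (X - 1)\<bar>, \<bar>2 * (2 * X - 3) * (3 * X - 2)\<bar>,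
      \<bar>- 2 * X * (12 * X - 11)\<bar>, \<bar>- 2 * X * (2 * X - 1)\<bar>} = 2 * X * (12 * X - 11)"
    and "X * (X - 1) * (4 * X - 1) * (36 * X\<^sup>2 - 69 * X + 25) > 1"
proof -
  let ?a = "- 12 * X * (X - 1)" and ?b = "2 * (2 * X - 3) * (3 * X - 2)"
  let ?c = "- 2 * X * (12 * X - 11)" and ?d = "- 2 * X * (2 * X - 1)"
  let ?n = "X * (X - 1) * (4 * X - 1) * (36 * X\<^sup>2 - 69 * X + 25)"
  have "2 * 2 \<le> t * t"
    using assms(2) by (intro mult_mono) auto
  then have X: "X \<ge> 4"
    by (simp add: X_def power2_eq_square)
  have "4 * X \<le> X * X"
    using X by (intro mult_right_mono) auto
  then have X2: "4 * X \<le> X\<^sup>2"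
    by (simp add: power2_eq_square)
  have eqs: "?a = 12 * X - 12 * X\<^sup>2" "?b = 12 * X\<^sup>2 - 26 * X + 12" "?c = 22 * X - 24 * X\<^sup>2"
    "?d = 2 * X - 4 * X\<^sup>2"
    by (simp_all add: algebra_simps power2_eq_square)
  \<comment> \<open>This chain makes \<open>?c\<close> the entry of largest absolute value and also
    yields distinctness and nonvanishing.\<close>
  have ord: "?c < ?a" "?a < ?d" "?d < 0" "0 < ?b" "?b < - ?c"
    using X X2 unfolding eqs by simp_all
  then show "Max {\<bar>?a\<bar>, \<bar>?b\<bar>, \<bar>?c\<bar>, \<bar>?d\<bar>} = 2 * X * (12 * X - 11)"
    by simp
  have "X * (X - 1) * (4 * X - 1) \<ge> 4 * 1 * 1"
    using X by (intro mult_mono) auto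
  moreover have "36 * X\<^sup>2 - 69 * X + 25 \<ge> 1"
    using X X2 by simp
  ultimately have "?n \<ge> 4 * 1 * 1 * 1"
    by (intro mult_mono[of "4 * 1 * 1"]) auto
  then show n1: "?n > 1"
    by simp
  \<comment> \<open>Stated for arbitrary integers, so that only the order matters and the
    polynomials stay opaque.\<close>
  have "distinct [a, b, c, d]" "0 \<notin> {a, b, c, d}"
    if "c < a" "a < d" "d < 0" "0 < b" for a b c d :: int
    using that by auto
  note dist = this[OF ord(1-4)]
  show "D_quadruple ?n {?a, ?b, ?c, ?d}"
  proof (rule D_quadrupleI)
    show "?a * ?b + ?n = (t * (12 * X - 13) * (X - 1))\<^sup>2"
      unfolding X_def by algebra
    \<comment> \<open>The four mixed pairs are the automatic ones: since \<open>?a + ?b\<close> is 2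
      \<alpha>, an entry x from the first two has root t x \<plusminus> \<epsilon>. The pairs
      \<open>?a\<close>, \<open>?b\<close> and \<open>?c\<close>, \<open>?d\<close> are the other
      two conditions.\<close>
    show "?a * ?c + ?n = (t * (?a + 5 * (1 - X)))\<^sup>2"
      unfolding X_def by algebra
    show "?a * ?d + ?n = (t * (?a - 5 * (1 - X)))\<^sup>2"
      unfolding X_def by algebra
    show "?b * ?c + ?n = (t * (?b + 5 * (1 - X)))\<^sup>2"
      unfolding X_def by algebra
    show "?b * ?d + ?n = (t * (?b - 5 * (1 - X)))\<^sup>2"
      unfolding X_def by algebra
    show "?c * ?d + ?n = (t * (12 * X\<^sup>2 - 15 * X + 5))\<^sup>2"
      unfolding X_def by algebra
  qed (use n1 in linarith, fact dist, fact dist)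
qed

section \<open>Reaching the prescribed exponents\<close>

lemma exponent_above_half:
  fixes \<delta> \<epsilon> :: real
  assumes "1 / 2 < \<delta>" and "\<delta> \<le> 4" and "\<epsilon> > 0"
  shows "\<exists>n a b c d :: int.
           \<not> is_square n \<and> \<bar>n\<bar> > 1 \<and> D_quadruple n {a, b, c, d} \<and>
           \<bar>ln (real_of_int (Max {\<bar>a\<bar>, \<bar>b\<bar>, \<bar>c\<bar>, \<bar>d\<bar>})) / ln (real_of_int \<bar>n\<bar>) - \<delta>\<bar> < \<epsilon>"
proof -
  \<comment> \<open>The factor 5 makes \<open>n t\<close> congruent to -1152, that is to 3, modulo
    5, and gives \<open>5 * int t >= 5\<close> for \<open>high_family\<close> when
    \<open>t > 0\<close>.\<close>
  define S :: "nat \<Rightarrow> int" where "S t = (5 * int t)\<^sup>2" for t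
  define n where "n t = 1152 * (3 * S t - 1)" for t
  define d where "d t = 15625 * S t ^ 4 - 8750 * S t ^ 3 + 725 * (S t)\<^sup>2 + 44 * S t + 36" for t
  \<comment> \<open>The solution of \<open>(8 + s) / (2 + 2 * s) = \<delta>\<close>, nonnegative for
    1/2 < \<delta> \<le> 4.\<close>
  define s where "s = (8 - 2 * \<delta>) / (2 * \<delta> - 1)"
  have s: "s \<ge> 0"
    using assms by (simp add: s_def)
  have "(8 + s) / (2 + 2 * s) = \<delta>"
    using assms s by (simp add: s_def field_simps)
  moreover have "\<exists>n a b c d :: int.
           \<not> is_square n \<and> \<bar>n\<bar> > 1 \<and> D_quadruple n {a, b, c, d} \<and>
           \<bar>ln (real_of_int (Max {\<bar>a\<bar>, \<bar>b\<bar>, \<bar>c\<bar>, \<bar>d\<bar>})) / ln (real_of_int \<bar>n\<bar>)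
             - (8 + s) / (2 + 2 * s)\<bar> < \<epsilon>"
  proof (rule scaled_family_exponent[where n = n and a = "\<lambda>_. 36" and b = "\<lambda>t. 4 * (25 * S t + 8)"
        and c = "\<lambda>t. 36 * (25 * (S t)\<^sup>2 - 6 * S t + 1)" and d = d])
    fix t :: nat assume t: "t > 0"
    show "D_quadruple (n t) {36, 4 * (25 * S t + 8), 36 * (25 * (S t)\<^sup>2 - 6 * S t + 1), d t}"
      unfolding n_def d_def S_def using t by (intro high_family) auto
    have nt: "n t = 5 * (17280 * int t ^ 2 - 231) + 3"
      by (simp add: n_def S_def power_mult_distrib)
    have "(5 * q + 3) mod 5 = 3" for q :: int
      by presburger
    with nt have "n t mod 5 = 3"
      by metis
    then show "\<not> is_square (n t)"
      by (rule nonsquare_mod_5)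
    have pos: "5 * (17280 * x - 231) + 3 > 1" if "1 \<le> x" for x :: int
      using that by simp
    have "1 \<le> (int t)\<^sup>2"
      using t by (simp add: one_le_power)
    from pos[OF this] have "n t > 1"
      unfolding nt .
    then show "\<bar>n t\<bar> > 1"
      by simp
  next
    have "(\<lambda>t. ln (real_of_int (d t)) / ln (real t)) \<longlonglongrightarrow> 8"
      unfolding d_def S_def of_int_add of_int_diff of_int_mult of_int_power of_int_numeral of_int_of_nat_eq
      by real_asymp
    moreover have "\<forall>\<^sub>F t in sequentially. ln (real_of_int (d t)) / ln (real t) =
        ln (real_of_int (Max {\<bar>36\<bar>, \<bar>4 * (25 * S t + 8)\<bar>,
          \<bar>36 * (25 * (S t)\<^sup>2 - 6 * S t + 1)\<bar>, \<bar>d t\<bar>})) / ln (real t)"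
      using eventually_gt_at_top[of 0]
    proof eventually_elim
      case (elim t)
      then show ?case
        unfolding d_def S_def by (subst high_family(2)) auto
    qed
    ultimately show "(\<lambda>t. ln (real_of_int (Max {\<bar>36\<bar>, \<bar>4 * (25 * S t + 8)\<bar>,
          \<bar>36 * (25 * (S t)\<^sup>2 - 6 * S t + 1)\<bar>, \<bar>d t\<bar>})) / ln (real t)) \<longlonglongrightarrow> 8"
      by (rule Lim_transform_eventually)
    show "(\<lambda>t. ln (real_of_int \<bar>n t\<bar>) / ln (real t)) \<longlonglongrightarrow> 2"
      unfolding n_def S_def of_int_add of_int_diff of_int_mult of_int_power of_int_numeral
        of_int_of_nat_eq of_int_abs of_int_1
      by real_asymp
  qed (use s assms in auto)
  ultimately show ?thesis
    by simp
qed

lemma exponent_below_half: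
  fixes \<delta> \<epsilon> :: real
  assumes "2 / 5 \<le> \<delta>" and "\<delta> < 1 / 2" and "\<epsilon> > 0"
  shows "\<exists>n a b c d :: int.
           \<not> is_square n \<and> \<bar>n\<bar> > 1 \<and> D_quadruple n {a, b, c, d} \<and>
           \<bar>ln (real_of_int (Max {\<bar>a\<bar>, \<bar>b\<bar>, \<bar>c\<bar>, \<bar>d\<bar>})) / ln (real_of_int \<bar>n\<bar>) - \<delta>\<bar> < \<epsilon>"
proof -
  \<comment> \<open>With base 2 modulo 11, \<open>X t\<close> is congruent to 4 and
    \<open>n t\<close> to 58500, that is to the non-residue 2. The base is also at least 2, as
    \<open>low_family\<close> requires.\<close>
  define X :: "nat \<Rightarrow> int" where "X t = (11 * int t + 2)\<^sup>2" for t
  define n where "n t = X t * (X t - 1) * (4 * X t - 1) * (36 * (X t)\<^sup>2 - 69 * X t + 25)" for t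
  define a where "a t = - 12 * X t * (X t - 1)" for t
  define b where "b t = 2 * (2 * X t - 3) * (3 * X t - 2)" for t
  define c where "c t = - 2 * X t * (12 * X t - 11)" for t
  define d where "d t = - 2 * X t * (2 * X t - 1)" for t
  \<comment> \<open>The solution of \<open>(4 + s) / (10 + 2 * s) = \<delta>\<close>, equal to 0 at
    \<delta> = 2/5.\<close>
  define s where "s = (10 * \<delta> - 4) / (1 - 2 * \<delta>)"
  have s: "s \<ge> 0"
    using assms by (simp add: s_def)
  have "(4 + s) / (10 + 2 * s) = \<delta>"
    using assms s by (simp add: s_def field_simps)
  moreover have "\<exists>n a b c d :: int.
           \<not> is_square n \<and> \<bar>n\<bar> > 1 \<and> D_quadruple n {a, b, c, d} \<and>
           \<bar>ln (real_of_int (Max {\<bar>a\<bar>, \<bar>b\<bar>, \<bar>c\<bar>, \<bar>d\<bar>})) / ln (real_of_int \<bar>n\<bar>)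
             - (4 + s) / (10 + 2 * s)\<bar> < \<epsilon>"
  proof (rule scaled_family_exponent[where n = n and a = a and b = b and c = c and d = d])
    fix t :: nat
    show "D_quadruple (n t) {a t, b t, c t, d t}"
      unfolding n_def a_def b_def c_def d_def X_def by (intro low_family) auto
    have "n t > 1"
      unfolding n_def X_def by (intro low_family) auto
    then show "\<bar>n t\<bar> > 1"
      by simp
    have X: "[X t = 2\<^sup>2] (mod 11)"
      unfolding X_def by (intro cong_pow) (simp add: cong_iff_dvd_diff)
    have "[n t = 2\<^sup>2 * (2\<^sup>2 - 1) * (4 * 2\<^sup>2 - 1) * (36 * (2\<^sup>2)\<^sup>2 - 69 * 2\<^sup>2 + 25)] (mod 11)"
      unfolding n_def by (intro cong_mult cong_diff cong_add cong_pow[of "X t"] cong_refl X)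
    then have "11 dvd n t - 58500"
      by (simp add: cong_iff_dvd_diff)
    then have "n t mod 11 = 2"
      by presburger
    then show "\<not> is_square (n t)"
      by (rule nonsquare_mod_11)
  next
    have "(\<lambda>t. ln (real_of_int (2 * X t * (12 * X t - 11))) / ln (real t)) \<longlonglongrightarrow> 4"
      unfolding X_def of_int_add of_int_diff of_int_mult of_int_power of_int_numeral of_int_of_nat_eq
      by real_asymp
    moreover have "2 * X t * (12 * X t - 11) = Max {\<bar>a t\<bar>, \<bar>b t\<bar>, \<bar>c t\<bar>, \<bar>d t\<bar>}" for t
      unfolding a_def b_def c_def d_def X_def by (subst low_family(2)) auto
    ultimately show "(\<lambda>t. ln (real_of_int (Max {\<bar>a t\<bar>, \<bar>b t\<bar>, \<bar>c t\<bar>, \<bar>d t\<bar>})) / ln (real t))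
        \<longlonglongrightarrow> 4"
      by simp
    show "(\<lambda>t. ln (real_of_int \<bar>n t\<bar>) / ln (real t)) \<longlonglongrightarrow> 10"
      unfolding n_def X_def of_int_add of_int_diff of_int_mult of_int_power of_int_numeral
        of_int_of_nat_eq of_int_abs of_int_1
      by real_asymp
  qed (use s assms in auto)
  ultimately show ?thesis
    by simp
qed

theorem theorem1p2:
  fixes \<delta> \<epsilon> :: real
  assumes "2 / 5 \<le> \<delta>" and "\<delta> \<le> 3" and "\<epsilon> > 0"
  shows "\<exists>n a b c d :: int.
           \<not> is_square n \<and> \<bar>n\<bar> > 1 \<and> D_quadruple n {a, b, c, d} \<and>
           \<bar>ln (real_of_int (Max {\<bar>a\<bar>, \<bar>b\<bar>, \<bar>c\<bar>, \<bar>d\<bar>})) / ln (real_of_int \<bar>n\<bar>) - \<delta>\<bar> < \<epsilon>"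
proof (cases \<delta> "1 / 2 :: real" rule: linorder_cases)
  case less
  with assms show ?thesis
    by (intro exponent_below_half)
next
  case greater
  with assms show ?thesis
    by (intro exponent_above_half) auto
next
  case equal
  \<comment> \<open>The value 1/2 is only a limit of the scaled exponents, so the target moves up by
    \<eta>. Half of \<epsilon> pays for the shift; the cap 1 keeps the target below 4.\<close>
  define \<eta> where "\<eta> = min 1 (\<epsilon> / 2)"
  have \<eta>: "0 < \<eta>" "\<eta> \<le> 1" "\<eta> \<le> \<epsilon> / 2"
    using assms by (auto simp: \<eta>_def)
  then have "1 / 2 < \<delta> + \<eta>" "\<delta> + \<eta> \<le> 4" "\<epsilon> / 2 > 0"
    using equal assms by auto
  from exponent_above_half[OF this] obtain n a b c d :: int where
    "\<not> is_square n" "\<bar>n\<bar> > 1" "D_quadruple n {a, b, c, d}"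
    "\<bar>ln (real_of_int (Max {\<bar>a\<bar>, \<bar>b\<bar>, \<bar>c\<bar>, \<bar>d\<bar>})) / ln (real_of_int \<bar>n\<bar>) - (\<delta> + \<eta>)\<bar> < \<epsilon> / 2"
    by blast
  moreover from this(4) \<eta>
  have "\<bar>ln (real_of_int (Max {\<bar>a\<bar>, \<bar>b\<bar>, \<bar>c\<bar>, \<bar>d\<bar>})) / ln (real_of_int \<bar>n\<bar>) - \<delta>\<bar> < \<epsilon>"
    by linarith
  ultimately show ?thesis
    by blast
qed

end
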